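(* Let $h\ge 2$ be an integer. There is an isomorphism of abelian groups \[ \mathbb Z^{h^2}/Q_h\mathbb Z^{h^2}\;\xrightarrow{\ \sim\ }\;\mathbb Z[X]/(P_h(X),P_h(-X)) \] which sends the class of $e\otimes e$ to the class of $1$.
   Context: For $h\ge2$, $C_h$ is the $h\times h$ integer tridiagonal matrix with all diagonal entries $2$, all superdiagonal entries $-1$, and all subdiagonal entries $-1$ except the one in the last row, $(C_h)_{h,h-1}$, which equals $-2$. Put $Q_h=C_h\otimes I_h+I_h\otimes C_h$ (Kronecker products, acting on column vectors in $\mathbb Z^{h}\otimes\mathbb Z^h=\mathbb Z^{h^2}$) and $e=(1,\dots,1)^T\in\mathbb Z^h$. The polynomials $P_j\in\mathbb Z[X]$ are defined by $P_0(X)=2$, $P_1(X)=2-X$, $P_{j+1}(X)=(2-X)P_j(X)-P_{j-1}(X)$ for $j\ge1$; equivalently $P_j(X)=2T_j(1-X/2)$ with $T_j$ the Chebyshev polynomials of the first kind. The isomorphism is between the cokernel of $Q_h$ acting on $\mathbb Z^{h^2}$ and the quotient of $\mathbb Z[X]$ by the ideal generated by $P_h(X)$ and $P_h(-X)$. *)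

theory Defs
  imports
    "Jordan_Normal_Form.Matrix"
    "Jordan_Normal_Form.VS_Connect"
    "HOL-Algebra.QuotRing"
    "HOL-Computational_Algebra.Polynomial"
begin

(* Kronecker products, with the lexicographic identification
   (i, k) |-> i * n + k of pairs of indices with a single index. *)

definition kronecker_mat :: "'a :: times mat \<Rightarrow> 'a mat \<Rightarrow> 'a mat" where
  "kronecker_mat A B =
     mat (dim_row A * dim_row B) (dim_col A * dim_col B)
       (\<lambda>(i, j). A $$ (i div dim_row B, j div dim_col B) * B $$ (i mod dim_row B, j mod dim_col B))"

definition kronecker_vec :: "'a :: times vec \<Rightarrow> 'a vec \<Rightarrow> 'a vec" where
  "kronecker_vec v w =
     vec (dim_vec v * dim_vec w) (\<lambda>i. v $ (i div dim_vec w) * w $ (i mod dim_vec w))"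

(* Indices start at 0, so the last row has index h - 1. *)
definition C_mat :: "nat \<Rightarrow> int mat" where
  "C_mat h = mat h h (\<lambda>(i, j).
     if i = j then 2
     else if j = i + 1 then - 1
     else if i = j + 1 then (if i = h - 1 then - 2 else - 1)
     else 0)"

definition Q_mat :: "nat \<Rightarrow> int mat" where
  "Q_mat h = kronecker_mat (C_mat h) (1\<^sub>m h) + kronecker_mat (1\<^sub>m h) (C_mat h)"

definition Q_image :: "nat \<Rightarrow> int vec set" where
  "Q_image h = (\<lambda>v. Q_mat h *\<^sub>v v) ` carrier_vec (h\<^sup>2)"

definition ones_vec :: "nat \<Rightarrow> int vec" where
  "ones_vec h = vec h (\<lambda>_. 1)"

fun P_poly :: "nat \<Rightarrow> int poly" where
  "P_poly 0 = 2"
| "P_poly (Suc 0) = 2 - [:0, 1:]"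
| "P_poly (Suc (Suc j)) = (2 - [:0, 1:]) * P_poly (Suc j) - P_poly j"

abbreviation Z_poly_ring :: "int poly ring" where
  "Z_poly_ring \<equiv> class_ring"

(* The polynomial P_h(-X) is the composition of P_h with -X. *)
definition P_ideal :: "nat \<Rightarrow> int poly set" where
  "P_ideal h = Idl\<^bsub>Z_poly_ring\<^esub> {P_poly h, pcompose (P_poly h) (- [:0, 1:])}"

end

theory Submission
  imports Defs
begin

text \<open>
  Let \<open>X\<close> act on \<open>\<int>\<^sup>h\<close> as the matrix \<open>C = C\<^sub>h\<close>.  Over \<open>\<int>[X]\<close> this is a cyclic module generated by
  \<open>e = (1,\<dots>,1)\<close>, and the annihilator of \<open>e\<close> is generated by \<open>P\<^sub>h\<close>, so that \<open>\<int>\<^sup>h\<close> is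
  \<open>\<int>[X]/(P\<^sub>h)\<close>.  Hence \<open>\<int>\<^sup>h \<otimes> \<int>\<^sup>h\<close> is \<open>\<int>[X,Y]/(P\<^sub>h(X), P\<^sub>h(Y))\<close>, where \<open>Q\<^sub>h\<close> acts as \<open>X + Y\<close>;
  dividing by its image puts \<open>Y = -X\<close> and leaves \<open>\<int>[X]/(P\<^sub>h(X), P\<^sub>h(-X))\<close>, with \<open>e \<otimes> e\<close> going
  to \<open>1\<close>.

  The proof works with explicit lifts, which keeps everything inside polynomials in one variable.
  In one direction \<open>C_act h p\<close> is the vector \<open>p(C) e\<close>.  In the other, the unit vector \<open>e\<^sub>i\<close> is
  \<open>u\<^sub>i(C) e\<close> for a polynomial \<open>u\<^sub>i\<close> (\<open>unit_poly\<close>), and \<open>vec_poly\<close> extends \<open>e\<^sub>i \<mapsto> u\<^sub>i\<close> linearly.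
  The \<open>u\<^sub>i\<close> are differences of polynomials \<open>T\<^sub>j\<close> (\<open>tail_poly\<close>) that satisfy the Chebyshev recurrence
  of the \<open>P\<^sub>j\<close> and produce the indicator vectors of the tails \<open>{j..<h}\<close>; the identity
  \<open>P\<^sub>j\<^sub>+\<^sub>1 = T\<^sub>j\<^sub>+\<^sub>1 + T\<^sub>j\<close> is what makes \<open>P\<^sub>h\<close> kill \<open>e\<close>.  The two lifts are inverse to each other,
  exactly on vectors (\<open>C_act_vec_poly\<close>) and modulo \<open>P\<^sub>h\<close> on polynomials
  (\<open>P_poly_dvd_vec_poly_C_act\<close>), and \<open>vec_poly\<close> turns \<open>C\<close> into multiplication by \<open>X\<close> modulo
  \<open>P\<^sub>h\<close> (\<open>P_poly_dvd_vec_poly_C_mat\<close>).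

  On \<open>\<int>\<^sup>h \<otimes> \<int>\<^sup>h\<close> the map to study is \<open>tensor_poly\<close>, which sends \<open>e\<^sub>i \<otimes> e\<^sub>k\<close> to \<open>u\<^sub>i(X) u\<^sub>k(-X)\<close>.  It
  maps the image of \<open>Q\<^sub>h\<close> into the ideal because \<open>X\<close> and \<open>-X\<close> cancel (\<open>tensor_poly_Q_mat\<close>).
  Conversely \<open>p \<mapsto> p(C) e \<otimes> e\<close> inverts it modulo the image of \<open>Q\<^sub>h\<close>
  (\<open>kronecker_C_act_tensor_poly\<close>) and sends the ideal into that image
  (\<open>kronecker_C_act_P_ideal\<close>); both rest on moving a polynomial across the tensor product at
  the price of \<open>X \<mapsto> -X\<close> (\<open>kronecker_C_act_transfer\<close>).  The first isomorphism theorem finishes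
  the proof.
\<close>

section \<open>Kronecker products\<close>

lemma sum_lessThan_mult:
  fixes f :: "nat \<Rightarrow> 'a :: comm_monoid_add"
  shows "(\<Sum>t<m * n. f t) = (\<Sum>i<m. \<Sum>j<n. f (i * n + j))"
proof -
  have "(\<Sum>i<m. \<Sum>j<n. f (i * n + j)) = (\<Sum>i<m. sum f {i * n..<i * n + n})"
  proof (rule sum.cong[OF refl])
    fix i
    show "(\<Sum>j<n. f (i * n + j)) = sum f {i * n..<i * n + n}"
      using sum.shift_bounds_nat_ivl[of f 0 "i * n" n]
      by (simp add: atLeast0LessThan add.commute)
  qed
  then show ?thesis
    by (simp add: sum.nat_group)
qed

lemma pair_index_less:
  fixes i j m n :: nat
  assumes "i < m" "j < n"
  shows "i * n + j < m * n"
proof -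
  have "i * n + j < (i + 1) * n"
    using assms by simp
  also have "\<dots> \<le> m * n"
    using assms by (intro mult_right_mono) auto
  finally show ?thesis .
qed

lemma kronecker_vec_carrier [simp]:
  "v \<in> carrier_vec m \<Longrightarrow> w \<in> carrier_vec n \<Longrightarrow> kronecker_vec v w \<in> carrier_vec (m * n)"
  by (rule carrier_vecI) (simp add: kronecker_vec_def)

lemma kronecker_vec_index:
  assumes "v \<in> carrier_vec m" "w \<in> carrier_vec n" "i < m" "j < n"
  shows "kronecker_vec v w $ (i * n + j) = v $ i * w $ j"
  using assms pair_index_less[of i m j n] by (auto simp: kronecker_vec_def)

lemma eq_vec_pair_indexI:
  assumes "v \<in> carrier_vec (m * n)" "w \<in> carrier_vec (m * n)"
    and "\<And>i j. i < m \<Longrightarrow> j < n \<Longrightarrow> v $ (i * n + j) = w $ (i * n + j)"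
  shows "v = w"
proof (rule eq_vecI)
  fix t assume "t < dim_vec w"
  then have t: "t < m * n"
    using assms by auto
  then have "n > 0"
    by (cases n) auto
  then show "v $ t = w $ t"
    using assms(3)[of "t div n" "t mod n"] t by (simp add: less_mult_imp_div_less)
qed (use assms in auto)

lemma kronecker_vec_add_left:
  fixes v v' w :: "'a :: semiring_0 vec"
  assumes "v \<in> carrier_vec m" "v' \<in> carrier_vec m" "w \<in> carrier_vec n"
  shows "kronecker_vec (v + v') w = kronecker_vec v w + kronecker_vec v' w"
  using assms
  by (intro eq_vecI) (auto simp: kronecker_vec_def less_mult_imp_div_less distrib_right)

lemma kronecker_vec_add_right:
  fixes v w w' :: "'a :: semiring_0 vec"
  assumes "v \<in> carrier_vec m" "w \<in> carrier_vec n" "w' \<in> carrier_vec n"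
  shows "kronecker_vec v (w + w') = kronecker_vec v w + kronecker_vec v w'"
proof (rule eq_vecI)
  fix i assume "i < dim_vec (kronecker_vec v w + kronecker_vec v w')"
  then have i: "i < m * n"
    using assms by (simp add: kronecker_vec_def)
  then have "n > 0"
    by (cases n) auto
  then show "kronecker_vec v (w + w') $ i = (kronecker_vec v w + kronecker_vec v w') $ i"
    using i assms by (simp add: kronecker_vec_def distrib_left)
qed (use assms in \<open>simp add: kronecker_vec_def\<close>)

lemma kronecker_vec_smult_left:
  fixes v w :: "'a :: comm_semiring_0 vec"
  shows "kronecker_vec (a \<cdot>\<^sub>v v) w = a \<cdot>\<^sub>v kronecker_vec v w"
  by (rule eq_vecI) (auto simp: kronecker_vec_def less_mult_imp_div_less mult.assoc)

lemma kronecker_vec_smult_right: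
  fixes v w :: "'a :: comm_semiring_0 vec"
  shows "kronecker_vec v (a \<cdot>\<^sub>v w) = a \<cdot>\<^sub>v kronecker_vec v w"
proof (rule eq_vecI)
  fix i assume "i < dim_vec (a \<cdot>\<^sub>v kronecker_vec v w)"
  then have i: "i < dim_vec v * dim_vec w"
    by (simp add: kronecker_vec_def)
  then have "dim_vec w > 0"
    by (cases "dim_vec w") auto
  then show "kronecker_vec v (a \<cdot>\<^sub>v w) $ i = (a \<cdot>\<^sub>v kronecker_vec v w) $ i"
    using i by (simp add: kronecker_vec_def ac_simps)
qed (simp add: kronecker_vec_def)

lemma kronecker_vec_zero_left:
  fixes w :: "'a :: semiring_0 vec"
  assumes "w \<in> carrier_vec n"
  shows "kronecker_vec (0\<^sub>v m) w = 0\<^sub>v (m * n)"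
  by (rule eq_vec_pair_indexI[of _ m n])
    (use assms in \<open>simp_all add: kronecker_vec_index[OF zero_carrier_vec assms] pair_index_less\<close>)

lemma kronecker_vec_zero_right:
  fixes v :: "'a :: semiring_0 vec"
  assumes "v \<in> carrier_vec m"
  shows "kronecker_vec v (0\<^sub>v n) = 0\<^sub>v (m * n)"
  by (rule eq_vec_pair_indexI[of _ m n])
    (use assms in \<open>simp_all add: kronecker_vec_index[OF assms zero_carrier_vec] pair_index_less\<close>)

lemma kronecker_mat_carrier [simp]:
  "A \<in> carrier_mat m m' \<Longrightarrow> B \<in> carrier_mat n n' \<Longrightarrow>
    kronecker_mat A B \<in> carrier_mat (m * n) (m' * n')"
  by (rule carrier_matI) (simp_all add: kronecker_mat_def)

lemma mult_mat_vec_index_sum: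
  assumes "A \<in> carrier_mat m n" "v \<in> carrier_vec n" "i < m"
  shows "(A *\<^sub>v v) $ i = (\<Sum>k<n. A $$ (i, k) * v $ k)"
proof -
  have "(A *\<^sub>v v) $ i = (\<Sum>k = 0..<n. row A i $ k * v $ k)"
    using assms by (simp add: scalar_prod_def)
  also have "\<dots> = (\<Sum>k<n. A $$ (i, k) * v $ k)"
    by (rule sum.cong) (use assms in auto)
  finally show ?thesis .
qed

lemma kronecker_mat_index:
  assumes "A \<in> carrier_mat m m'" "B \<in> carrier_mat n n'"
    and "i < m" "j < n" "k < m'" "l < n'"
  shows "kronecker_mat A B $$ (i * n + j, k * n' + l) = A $$ (i, k) * B $$ (j, l)"
  using assms pair_index_less[of i m j n] pair_index_less[of k m' l n']
  by (simp add: kronecker_mat_def)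

lemma kronecker_mat_mult_vec:
  fixes A B :: "'a :: comm_semiring_0 mat"
  assumes A: "A \<in> carrier_mat m m'" and B: "B \<in> carrier_mat n n'"
    and v: "v \<in> carrier_vec m'" and w: "w \<in> carrier_vec n'"
  shows "kronecker_mat A B *\<^sub>v kronecker_vec v w = kronecker_vec (A *\<^sub>v v) (B *\<^sub>v w)"
proof (rule eq_vec_pair_indexI[of _ m n])
  fix i j assume ij: "i < m" "j < n"
  have "(kronecker_mat A B *\<^sub>v kronecker_vec v w) $ (i * n + j)
      = (\<Sum>t<m' * n'. kronecker_mat A B $$ (i * n + j, t) * kronecker_vec v w $ t)"
    by (rule mult_mat_vec_index_sum[OF kronecker_mat_carrier[OF A B]
          kronecker_vec_carrier[OF v w] pair_index_less[OF ij]])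
  also have "\<dots> = (\<Sum>k<m'. \<Sum>l<n'. (A $$ (i, k) * B $$ (j, l)) * (v $ k * w $ l))"
    unfolding sum_lessThan_mult
    by (intro sum.cong refl arg_cong2[where f = "(*)"]
        kronecker_mat_index[OF A B] kronecker_vec_index[OF v w] ij) simp_all
  also have "\<dots> = (\<Sum>k<m'. A $$ (i, k) * v $ k) * (\<Sum>l<n'. B $$ (j, l) * w $ l)"
    unfolding sum_product by (intro sum.cong refl) (simp add: ac_simps)
  also have "\<dots> = (A *\<^sub>v v) $ i * (B *\<^sub>v w) $ j"
    using mult_mat_vec_index_sum[OF A v ij(1)] mult_mat_vec_index_sum[OF B w ij(2)] by simp
  also have "\<dots> = kronecker_vec (A *\<^sub>v v) (B *\<^sub>v w) $ (i * n + j)"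
    by (rule kronecker_vec_index[symmetric, OF mult_mat_vec_carrier[OF A v]
          mult_mat_vec_carrier[OF B w] ij])
  finally show "(kronecker_mat A B *\<^sub>v kronecker_vec v w) $ (i * n + j)
      = kronecker_vec (A *\<^sub>v v) (B *\<^sub>v w) $ (i * n + j)" .
next
  show "kronecker_mat A B *\<^sub>v kronecker_vec v w \<in> carrier_vec (m * n)"
    by (rule mult_mat_vec_carrier[OF kronecker_mat_carrier[OF A B] kronecker_vec_carrier[OF v w]])
  show "kronecker_vec (A *\<^sub>v v) (B *\<^sub>v w) \<in> carrier_vec (m * n)"
    by (rule kronecker_vec_carrier[OF mult_mat_vec_carrier[OF A v] mult_mat_vec_carrier[OF B w]])
qed

text \<open>
  Pure tensors generate the tensor product as an additive group, since a scalar can be absorbed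
  into one of the factors.
\<close>
lemma kronecker_vec_induct [consumes 1, case_names zero add kronecker]:
  fixes u :: "'a :: semiring_1 vec"
  assumes u: "u \<in> carrier_vec (m * n)"
    and zero: "Q (0\<^sub>v (m * n))"
    and add: "\<And>u u'. u \<in> carrier_vec (m * n) \<Longrightarrow> u' \<in> carrier_vec (m * n) \<Longrightarrow>
      Q u \<Longrightarrow> Q u' \<Longrightarrow> Q (u + u')"
    and kron: "\<And>v w. v \<in> carrier_vec m \<Longrightarrow> w \<in> carrier_vec n \<Longrightarrow> Q (kronecker_vec v w)"
  shows "Q u"
proof -
  \<comment> \<open>The entries of \<open>u\<close> are added one at a time, each as a pure tensor of two multiples of unit
    vectors.\<close>
  define trunc where "trunc k = vec (m * n) (\<lambda>t. if t < k then u $ t else 0)" for k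
  have "Q (trunc k)" if "k \<le> m * n" for k
    using that
  proof (induction k)
    case 0
    have "trunc 0 = 0\<^sub>v (m * n)"
      by (rule eq_vecI) (simp_all add: trunc_def)
    with zero show ?case by simp
  next
    case (Suc k)
    define v where "v = vec m (\<lambda>i. if i = k div n then u $ k else 0)"
    define w :: "'a vec" where "w = vec n (\<lambda>j. if j = k mod n then 1 else 0)"
    have "trunc (Suc k) = trunc k + kronecker_vec v w"
    proof (rule eq_vecI)
      fix t assume "t < dim_vec (trunc k + kronecker_vec v w)"
      then have t: "t < m * n"
        by (simp add: v_def w_def kronecker_vec_def)
      then have n: "n > 0"
        by (cases n) auto
      have "kronecker_vec v w $ t = v $ (t div n) * w $ (t mod n)"
        using t by (simp add: kronecker_vec_def v_def w_def)
      also have "\<dots> = (if t div n = k div n \<and> t mod n = k mod n then u $ k else 0)"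
        using less_mult_imp_div_less[OF t] n by (simp add: v_def w_def)
      also have "t div n = k div n \<and> t mod n = k mod n \<longleftrightarrow> t = k"
        by (metis div_mult_mod_eq)
      finally have entry: "kronecker_vec v w $ t = (if t = k then u $ k else 0)" .
      have "(trunc k + kronecker_vec v w) $ t = trunc k $ t + kronecker_vec v w $ t"
        by (rule index_add_vec) (simp add: kronecker_vec_def v_def w_def t)
      then show "trunc (Suc k) $ t = (trunc k + kronecker_vec v w) $ t"
        unfolding entry using t by (simp add: trunc_def less_Suc_eq)
    qed (simp add: trunc_def v_def w_def kronecker_vec_def)
    then show ?case
      using Suc add[of "trunc k" "kronecker_vec v w"] kron[of v w]
      by (simp add: trunc_def v_def w_def)
  qed
  moreover have "trunc (m * n) = u"
    using u by (intro eq_vecI) (auto simp: trunc_def)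
  ultimately show ?thesis
    by (metis order_refl)
qed

section \<open>The action of a polynomial on a vector\<close>

text \<open>
  The vector \<open>p(M) e\<close>, evaluated by Horner's scheme.
\<close>
definition poly_act :: "'a :: comm_ring_1 mat \<Rightarrow> 'a vec \<Rightarrow> 'a poly \<Rightarrow> 'a vec" where
  "poly_act M e p = fold_coeffs (\<lambda>a v. a \<cdot>\<^sub>v e + M *\<^sub>v v) p (0\<^sub>v (dim_vec e))"

context
  fixes M :: "'a :: comm_ring_1 mat" and e :: "'a vec" and n :: nat
  assumes M: "M \<in> carrier_mat n n" and e: "e \<in> carrier_vec n"
begin

lemma poly_act_0: "poly_act M e 0 = 0\<^sub>v n"
  using e by (simp add: poly_act_def)

lemma poly_act_pCons: "poly_act M e (pCons a p) = a \<cdot>\<^sub>v e + M *\<^sub>v poly_act M e p"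
proof (cases "a = 0 \<and> p = 0")
  case True
  have "M *\<^sub>v 0\<^sub>v n = 0\<^sub>v n" "0 \<cdot>\<^sub>v e = 0\<^sub>v n"
    using M e by auto
  then show ?thesis
    using True by (simp add: poly_act_0)
next
  case False
  then show ?thesis
    by (cases "a = 0") (auto simp: poly_act_def)
qed

lemma poly_act_carrier [simp]: "poly_act M e p \<in> carrier_vec n"
  by (induction p) (use M e in \<open>auto simp: poly_act_0 poly_act_pCons\<close>)

lemma poly_act_add: "poly_act M e (p + q) = poly_act M e p + poly_act M e q"
proof (induction p q rule: poly_induct2)
  case (pCons a p b q)
  let ?p = "poly_act M e p" and ?q = "poly_act M e q"
  have "M *\<^sub>v (?p + ?q) = M *\<^sub>v ?p + M *\<^sub>v ?q"
    using M by (rule mult_add_distrib_mat_vec) simp_all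
  moreover have "M *\<^sub>v ?p \<in> carrier_vec n" "M *\<^sub>v ?q \<in> carrier_vec n"
    using M by (auto intro: mult_mat_vec_carrier)
  ultimately show ?case
    using e pCons by (auto simp: poly_act_pCons add_smult_distrib_vec intro!: eq_vecI)
qed (simp add: poly_act_0)

lemma poly_act_const_mult: "poly_act M e ([:a:] * p) = a \<cdot>\<^sub>v poly_act M e p"
proof (induction p)
  case 0
  have "a \<cdot>\<^sub>v 0\<^sub>v n = 0\<^sub>v n"
    by auto
  then show ?case
    by (simp add: poly_act_0)
next
  case (pCons b p)
  have "a \<cdot>\<^sub>v (b \<cdot>\<^sub>v e + M *\<^sub>v poly_act M e p) = (a * b) \<cdot>\<^sub>v e + a \<cdot>\<^sub>v (M *\<^sub>v poly_act M e p)"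
    using e M smult_add_distrib_vec[of "b \<cdot>\<^sub>v e" n "M *\<^sub>v poly_act M e p" a]
    by (simp add: smult_smult_assoc mult_mat_vec_carrier)
  also have "a \<cdot>\<^sub>v (M *\<^sub>v poly_act M e p) = M *\<^sub>v (a \<cdot>\<^sub>v poly_act M e p)"
    by (rule eq_vecI)
      (use M in \<open>auto simp: scalar_prod_smult_distrib[OF _ poly_act_carrier]\<close>)
  finally show ?case
    using pCons by (simp add: poly_act_pCons mult.commute)
qed

lemma poly_act_X_mult: "poly_act M e ([:0, 1:] * p) = M *\<^sub>v poly_act M e p"
proof -
  have "M *\<^sub>v poly_act M e p \<in> carrier_vec n"
    using M by (rule mult_mat_vec_carrier) simp
  moreover have "0 \<cdot>\<^sub>v e = 0\<^sub>v n"
    using e by auto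
  ultimately show ?thesis
    by (simp add: poly_act_pCons)
qed

lemma poly_act_1: "poly_act M e 1 = e"
proof -
  have "M *\<^sub>v 0\<^sub>v n = 0\<^sub>v n"
    using M by auto
  then show ?thesis
    using e by (simp add: one_pCons poly_act_pCons poly_act_0)
qed

lemma poly_act_diff: "poly_act M e (p - q) = poly_act M e p - poly_act M e q"
proof -
  have "p - q = p + [:-1:] * q"
    by simp
  then have "poly_act M e (p - q) = poly_act M e p + (-1) \<cdot>\<^sub>v poly_act M e q"
    by (metis poly_act_add poly_act_const_mult)
  then show ?thesis
    by (auto intro!: eq_vecI)
qed

text \<open>
  The annihilator of the cyclic vector is an ideal, because every power of the matrix preserves zero.
\<close>
lemma poly_act_mult_eq_0:
  assumes "poly_act M e q = 0\<^sub>v n"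
  shows "poly_act M e (p * q) = 0\<^sub>v n"
proof (induction p)
  case (pCons a p)
  have "pCons a p * q = [:a:] * q + [:0, 1:] * (p * q)"
    by simp
  then have "poly_act M e (pCons a p * q) = a \<cdot>\<^sub>v 0\<^sub>v n + M *\<^sub>v 0\<^sub>v n"
    by (simp only: poly_act_add poly_act_const_mult poly_act_X_mult pCons assms)
  also have "M *\<^sub>v 0\<^sub>v n = 0\<^sub>v n"
    using M by auto
  finally show ?case
    by auto
qed (simp add: poly_act_0)

end

section \<open>The matrix C as multiplication by X\<close>

lemma C_mat_carrier [simp]: "C_mat h \<in> carrier_mat h h"
  by (simp add: C_mat_def)

lemma ones_vec_carrier [simp]: "ones_vec h \<in> carrier_vec h"
  by (simp add: ones_vec_def)

text \<open>
  The extension of the recurrence by \<open>T\<^sub>-\<^sub>1 = 1\<close> characterises these polynomials; in Chebyshev terms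
  \<open>T\<^sub>j(2 - 2 cos \<theta>) = cos ((j + 1/2) \<theta>) / cos (\<theta>/2)\<close>.  They are chosen so that \<open>T\<^sub>j(C) e\<close> is the
  indicator vector of \<open>{j..<h}\<close>.
\<close>
fun tail_poly :: "nat \<Rightarrow> int poly" where
  "tail_poly 0 = 1"
| "tail_poly (Suc 0) = 1 - [:0, 1:]"
| "tail_poly (Suc (Suc j)) = (2 - [:0, 1:]) * tail_poly (Suc j) - tail_poly j"

text \<open>
  Both sides satisfy the same three-term recurrence.  This relation is the bridge between the
  annihilating polynomial and the tails.
\<close>
lemma P_poly_Suc: "P_poly (Suc j) = tail_poly (Suc j) + tail_poly j"
proof -
  \<comment> \<open>Kept atomic, because the simplifier would turn products with \<open>[:0, 1:]\<close> into \<open>pCons\<close> terms.\<close>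
  define x where "x = [:0, 1 :: int:]"
  note P = P_poly.simps[folded x_def] and T = tail_poly.simps[folded x_def]
  show ?thesis
  proof (induction j rule: tail_poly.induct)
    case 1
    show ?case
      by (simp only: P T)
  next
    case 2
    show ?case
      by (simp only: One_nat_def P T) (simp add: algebra_simps)
  next
    case (3 j)
    have "P_poly (Suc (Suc (Suc j))) = (2 - x) * (tail_poly (Suc (Suc j)) + tail_poly (Suc j))
        - (tail_poly (Suc j) + tail_poly j)"
      by (simp only: P(3)[of "Suc j"] 3)
    also have "\<dots> = ((2 - x) * tail_poly (Suc (Suc j)) - tail_poly (Suc j))
        + ((2 - x) * tail_poly (Suc j) - tail_poly j)"
      by (simp only: distrib_left)
    finally show ?case
      by (simp only: T(3))
  qed
qed

definition tail_vec :: "nat \<Rightarrow> nat \<Rightarrow> int vec" where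
  "tail_vec h j = vec h (\<lambda>i. if j \<le> i then 1 else 0)"

lemma tail_vec_carrier [simp]: "tail_vec h j \<in> carrier_vec h"
  by (simp add: tail_vec_def)

text \<open>
  The doubled subdiagonal entry of the last row is a reflecting boundary condition, while the first
  row has a vanishing one.
\<close>
lemma C_mat_mult_vec_index:
  assumes v: "v \<in> carrier_vec h" and i: "i < h"
  shows "(C_mat h *\<^sub>v v) $ i = 2 * v $ i - (if Suc i < h then v $ Suc i else 0)
    - (if i = 0 then 0 else (if Suc i = h then 2 else 1) * v $ (i - 1))"
proof -
  let ?c = "if Suc i = h then 2 else 1 :: int"
  have "(C_mat h *\<^sub>v v) $ i = (\<Sum>k<h. C_mat h $$ (i, k) * v $ k)"
    by (rule mult_mat_vec_index_sum[OF C_mat_carrier v i])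
  also have "\<dots> = (\<Sum>k<h. (if k = i then 2 * v $ k else 0) - (if k = Suc i then v $ k else 0)
      - (if k = i - 1 then if i = 0 then 0 else ?c * v $ k else 0))"
    by (rule sum.cong) (use i in \<open>auto simp: C_mat_def\<close>)
  also have "\<dots> = 2 * v $ i - (if Suc i < h then v $ Suc i else 0)
      - (if i = 0 then 0 else ?c * v $ (i - 1))"
    using i by (simp add: sum_subtractf)
  finally show ?thesis .
qed

text \<open>
  The start of the recurrence: since every tail from index \<open>0\<close> downwards is \<open>e\<close>, this is the
  generic recurrence step with \<open>T\<^sub>-\<^sub>1 = 1\<close>.
\<close>
lemma C_mat_mult_tail_vec_0:
  assumes "h \<ge> 2"
  shows "tail_vec h 0 - C_mat h *\<^sub>v tail_vec h 0 = tail_vec h 1"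
proof (rule eq_vecI)
  fix i assume "i < dim_vec (tail_vec h 1)"
  then have i: "i < h"
    by (simp add: tail_vec_def)
  have "(tail_vec h 0 - C_mat h *\<^sub>v tail_vec h 0) $ i
      = tail_vec h 0 $ i - (C_mat h *\<^sub>v tail_vec h 0) $ i"
    using i by (intro index_minus_vec) (simp add: C_mat_def)
  then show "(tail_vec h 0 - C_mat h *\<^sub>v tail_vec h 0) $ i = tail_vec h 1 $ i"
    unfolding C_mat_mult_vec_index[OF tail_vec_carrier i]
    using i assms by (auto simp: tail_vec_def)
qed (simp add: tail_vec_def C_mat_def)

text \<open>
  At the last index the reflecting row makes the recurrence return minus the last tail, where the
  pattern of the other indices would give the zero vector.
\<close>
lemma C_mat_mult_tail_vec:
  assumes "Suc j < h"
  shows "2 \<cdot>\<^sub>v tail_vec h (Suc j) - C_mat h *\<^sub>v tail_vec h (Suc j) - tail_vec h j =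
    (if Suc (Suc j) = h then (-1) \<cdot>\<^sub>v tail_vec h (Suc j) else tail_vec h (Suc (Suc j)))"
    (is "?l = ?r")
proof (rule eq_vecI)
  fix i assume "i < dim_vec ?r"
  then have i: "i < h"
    by (simp add: tail_vec_def split: if_splits)
  have "?l $ i = 2 * tail_vec h (Suc j) $ i - (C_mat h *\<^sub>v tail_vec h (Suc j)) $ i
      - tail_vec h j $ i"
    using i by (simp add: tail_vec_def C_mat_def del: index_mult_mat_vec)
  then show "?l $ i = ?r $ i"
    unfolding C_mat_mult_vec_index[OF tail_vec_carrier i]
    using i assms by (auto simp: tail_vec_def)
qed (simp add: tail_vec_def C_mat_def)

abbreviation C_act :: "nat \<Rightarrow> int poly \<Rightarrow> int vec" where
  "C_act h \<equiv> poly_act (C_mat h) (ones_vec h)"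

lemmas C_act_carrier [simp] = poly_act_carrier[OF C_mat_carrier ones_vec_carrier]
lemmas C_act_0 = poly_act_0[OF C_mat_carrier ones_vec_carrier]
lemmas C_act_1 = poly_act_1[OF C_mat_carrier ones_vec_carrier]
lemmas C_act_add = poly_act_add[OF C_mat_carrier ones_vec_carrier]
lemmas C_act_diff = poly_act_diff[OF C_mat_carrier ones_vec_carrier]
lemmas C_act_const_mult = poly_act_const_mult[OF C_mat_carrier ones_vec_carrier]
lemmas C_act_X_mult = poly_act_X_mult[OF C_mat_carrier ones_vec_carrier]
lemmas C_act_mult_eq_0 = poly_act_mult_eq_0[OF C_mat_carrier ones_vec_carrier]

lemma C_act_recurrence:
  "C_act h ((2 - [:0, 1:]) * p - q) = 2 \<cdot>\<^sub>v C_act h p - C_mat h *\<^sub>v C_act h p - C_act h q"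
proof -
  have "(2 - [:0, 1:]) * p - q = [:2:] * p - [:0, 1:] * p - q"
    by (simp add: left_diff_distrib numeral_poly)
  then show ?thesis
    by (simp only: C_act_diff C_act_const_mult C_act_X_mult)
qed

lemma C_act_tail_poly:
  assumes "h \<ge> 2" "j < h"
  shows "C_act h (tail_poly j) = tail_vec h j"
proof -
  have ones: "ones_vec h = tail_vec h 0"
    by (rule eq_vecI) (simp_all add: ones_vec_def tail_vec_def)
  show ?thesis
    using assms(2)
  proof (induction j rule: tail_poly.induct)
    case 1
    show ?case
      unfolding tail_poly.simps C_act_1 by (rule ones)
  next
    case 2
    have "1 - [:0, 1:] = 1 - [:0, 1:] * (1 :: int poly)"
      by simp
    then have "C_act h (1 - [:0, 1:]) = ones_vec h - C_mat h *\<^sub>v ones_vec h"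
      by (simp only: C_act_diff C_act_X_mult C_act_1)
    then show ?case
      using C_mat_mult_tail_vec_0[OF assms(1)] ones by simp
  next
    case (3 j)
    then show ?case
      by (simp add: C_act_recurrence C_mat_mult_tail_vec del: mult_pCons_left)
  qed
qed

text \<open>
  At the reflecting end \<open>T\<^sub>h(C) e = - T\<^sub>h\<^sub>-\<^sub>1(C) e\<close>, and \<open>P\<^sub>h\<close> is the sum of these two polynomials.
\<close>
lemma C_act_P_poly:
  assumes "h \<ge> 2"
  shows "C_act h (P_poly h) = 0\<^sub>v h"
proof -
  obtain j where j: "h = Suc (Suc j)"
    using assms by (metis add_2_eq_Suc le_Suc_ex)
  have "C_act h (tail_poly h) = (-1) \<cdot>\<^sub>v tail_vec h (Suc j)"
    using C_act_tail_poly[OF assms, of j] C_act_tail_poly[OF assms, of "Suc j"]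
      C_mat_mult_tail_vec[of j h] j
    by (simp add: C_act_recurrence del: mult_pCons_left)
  then have "C_act h (P_poly h) = (-1) \<cdot>\<^sub>v tail_vec h (Suc j) + tail_vec h (Suc j)"
    using C_act_tail_poly[OF assms, of "Suc j"] j
    by (simp add: P_poly_Suc C_act_add del: P_poly.simps tail_poly.simps)
  also have "\<dots> = 0\<^sub>v h"
    by (rule eq_vecI) (simp_all add: tail_vec_def)
  finally show ?thesis .
qed

text \<open>
  A unit vector is the difference of two consecutive tails.  The last one is a tail itself; the
  formula for the other indices would be correct there only with \<open>T\<^sub>h\<close> replaced by \<open>0\<close>, which is
  not its value modulo \<open>P\<^sub>h\<close>.
\<close>
definition unit_poly :: "nat \<Rightarrow> nat \<Rightarrow> int poly" where
  "unit_poly h i = (if Suc i = h then tail_poly i else tail_poly i - tail_poly (Suc i))"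

lemma C_act_unit_poly:
  assumes "h \<ge> 2" "i < h"
  shows "C_act h (unit_poly h i) = unit_vec h i"
proof (cases "Suc i = h")
  case True
  have "tail_vec h i = unit_vec h i"
    by (rule eq_vecI) (use True in \<open>auto simp: tail_vec_def\<close>)
  then show ?thesis
    using True C_act_tail_poly[OF assms] by (simp add: unit_poly_def)
next
  case False
  then have "Suc i < h"
    using assms by simp
  have "tail_vec h i - tail_vec h (Suc i) = unit_vec h i"
    by (rule eq_vecI) (use assms in \<open>auto simp: tail_vec_def\<close>)
  then show ?thesis
    using False C_act_tail_poly[OF assms] C_act_tail_poly[OF assms(1) \<open>Suc i < h\<close>]
    by (simp add: unit_poly_def C_act_diff)
qed

definition vec_poly :: "nat \<Rightarrow> int vec \<Rightarrow> int poly" where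
  "vec_poly h v = (\<Sum>i<h. [:v $ i:] * unit_poly h i)"

lemma vec_poly_add:
  assumes "v \<in> carrier_vec h" "w \<in> carrier_vec h"
  shows "vec_poly h (v + w) = vec_poly h v + vec_poly h w"
  unfolding vec_poly_def sum.distrib[symmetric]
  by (rule sum.cong) (use assms in \<open>auto simp: smult_add_left\<close>)

lemma vec_poly_smult:
  assumes "v \<in> carrier_vec h"
  shows "vec_poly h (a \<cdot>\<^sub>v v) = [:a:] * vec_poly h v"
  unfolding vec_poly_def sum_distrib_left
  by (rule sum.cong) (use assms in \<open>auto simp: mult.commute\<close>)

text \<open>
  The sum of the \<open>u\<^sub>i\<close> telescopes to \<open>T\<^sub>0\<close>.
\<close>
lemma vec_poly_ones:
  assumes "h \<ge> 2"
  shows "vec_poly h (ones_vec h) = 1"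
proof -
  obtain m where h: "h = Suc m"
    using assms by (cases h) auto
  have "vec_poly h (ones_vec h) = (\<Sum>i<h. unit_poly h i)"
    unfolding vec_poly_def by (rule sum.cong) (simp_all add: ones_vec_def)
  also have "\<dots> = (\<Sum>i<m. tail_poly i - tail_poly (Suc i)) + tail_poly m"
    by (simp add: h unit_poly_def del: tail_poly.simps)
  also have "(\<Sum>i<m. tail_poly i - tail_poly (Suc i)) = tail_poly 0 - tail_poly m"
    by (rule sum_lessThan_telescope')
  finally show ?thesis
    by simp
qed

lemma C_act_vec_poly:
  assumes "h \<ge> 2" "v \<in> carrier_vec h"
  shows "C_act h (vec_poly h v) = v"
proof -
  have "C_act h (\<Sum>i<k. [:v $ i:] * unit_poly h i) = vec h (\<lambda>i. if i < k then v $ i else 0)"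
    if "k \<le> h" for k
    using that
  proof (induction k)
    case 0
    show ?case
      by (rule eq_vecI) (simp_all add: C_act_0)
  next
    case (Suc k)
    have "C_act h (\<Sum>i<Suc k. [:v $ i:] * unit_poly h i)
        = vec h (\<lambda>i. if i < k then v $ i else 0) + v $ k \<cdot>\<^sub>v unit_vec h k"
      using Suc C_act_unit_poly[OF assms(1), of k]
      by (simp add: C_act_add C_act_const_mult del: mult_pCons_left)
    also have "\<dots> = vec h (\<lambda>i. if i < Suc k then v $ i else 0)"
      by (rule eq_vecI) (auto simp: unit_vec_def less_Suc_eq)
    finally show ?case .
  qed
  from this[of h] have "C_act h (vec_poly h v) = vec h (\<lambda>i. if i < h then v $ i else 0)"
    unfolding vec_poly_def by simp
  also have "\<dots> = v"
    by (rule eq_vecI) (use assms in auto)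
  finally show ?thesis .
qed

text \<open>
  Away from the last two columns the recurrence for the tails gives equality.  The last two columns
  see the exceptional \<open>u\<^sub>h\<^sub>-\<^sub>1\<close>, and the error is exactly \<open>\<plusminus>P\<^sub>h\<close>.
\<close>
lemma P_poly_dvd_C_mat_column:
  assumes "h \<ge> 2" "k < h"
  shows "P_poly h dvd (\<Sum>i<h. [:C_mat h $$ (i, k):] * unit_poly h i) - [:0, 1:] * unit_poly h k"
proof -
  define x where "x = [:0, 1 :: int:]"
  let ?c = "if Suc (Suc k) = h then 2 else 1 :: int poly"
  note T = tail_poly.simps[folded x_def]
  have "(\<Sum>i<h. [:C_mat h $$ (i, k):] * unit_poly h i)
      = (\<Sum>i<h. (if i = k then 2 * unit_poly h i else 0)
        - (if i = k - 1 then if k = 0 then 0 else unit_poly h i else 0)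
        - (if i = Suc k then ?c * unit_poly h i else 0))"
  proof (rule sum.cong[OF refl])
    fix i assume "i \<in> {..<h}"
    moreover have "[:2:] = (2 :: int poly)" "[:-1:] = (-1 :: int poly)" "[:-2:] = (-2 :: int poly)"
      by (simp_all add: numeral_poly one_pCons)
    ultimately show "[:C_mat h $$ (i, k):] * unit_poly h i = (if i = k then 2 * unit_poly h i else 0)
        - (if i = k - 1 then if k = 0 then 0 else unit_poly h i else 0)
        - (if i = Suc k then ?c * unit_poly h i else 0)"
      using assms(2) by (auto simp: C_mat_def simp del: mult_pCons_left)
  qed
  also have "\<dots> = 2 * unit_poly h k - (if k = 0 then 0 else unit_poly h (k - 1))
      - (if Suc k < h then ?c * unit_poly h (Suc k) else 0)"
    using assms(2) by (simp add: sum_subtractf)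
  also have "\<dots> - x * unit_poly h k \<in> {0, P_poly h, - P_poly h}"
  proof (cases k)
    case 0
    obtain j where "h = Suc (Suc j)"
      using assms by (metis add_2_eq_Suc le_Suc_ex)
    then show ?thesis
      using 0 by (cases j) (auto simp: unit_poly_def P_poly_Suc T algebra_simps
          simp del: P_poly.simps tail_poly.simps(2,3) mult_pCons_left)
  next
    case (Suc j)
    consider "h = Suc k" | "h = Suc (Suc k)" | "Suc (Suc k) < h"
      using assms by linarith
    then show ?thesis
      by cases (auto simp: Suc unit_poly_def P_poly_Suc T algebra_simps
          simp del: P_poly.simps tail_poly.simps(2,3) mult_pCons_left)
  qed
  finally show ?thesis
    unfolding x_def by auto
qed

lemma P_poly_dvd_vec_poly_C_mat:
  assumes "h \<ge> 2" "v \<in> carrier_vec h"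
  shows "P_poly h dvd vec_poly h (C_mat h *\<^sub>v v) - [:0, 1:] * vec_poly h v"
proof -
  let ?x = "[:0, 1:] :: int poly"
  have "[:(C_mat h *\<^sub>v v) $ i:] * u = (\<Sum>k<h. [:v $ k:] * ([:C_mat h $$ (i, k):] * u))"
    if "i < h" for i u
  proof -
    have "[:(C_mat h *\<^sub>v v) $ i:] = (\<Sum>k<h. [:v $ k:] * [:C_mat h $$ (i, k):])"
      unfolding mult_mat_vec_index_sum[OF C_mat_carrier assms(2) that]
      by (rule poly_eqI) (simp add: coeff_sum coeff_pCons mult.commute split: nat.split)
    then show ?thesis
      by (simp only: sum_distrib_right mult.assoc)
  qed
  then have "vec_poly h (C_mat h *\<^sub>v v)
      = (\<Sum>i<h. \<Sum>k<h. [:v $ k:] * ([:C_mat h $$ (i, k):] * unit_poly h i))"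
    unfolding vec_poly_def by (intro sum.cong refl) simp
  also have "\<dots> = (\<Sum>k<h. [:v $ k:] * (\<Sum>i<h. [:C_mat h $$ (i, k):] * unit_poly h i))"
    unfolding sum_distrib_left by (rule sum.swap)
  also have "\<dots> - ?x * vec_poly h v = (\<Sum>k<h. [:v $ k:] *
      ((\<Sum>i<h. [:C_mat h $$ (i, k):] * unit_poly h i) - ?x * unit_poly h k))"
    unfolding vec_poly_def right_diff_distrib sum_subtractf sum_distrib_left[of ?x]
    by (simp only: mult.left_commute)
  finally show ?thesis
    by (auto intro!: dvd_sum dvd_mult P_poly_dvd_C_mat_column assms simp del: mult_pCons_left)
qed

text \<open>
  Horner's scheme for \<open>p(C) e\<close> is carried to Horner's scheme for \<open>p\<close>, since \<open>e\<close> goes to \<open>1\<close> and \<open>C\<close>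
  becomes multiplication by \<open>X\<close>.
\<close>
lemma P_poly_dvd_vec_poly_C_act:
  assumes "h \<ge> 2"
  shows "P_poly h dvd vec_poly h (C_act h p) - p"
proof (induction p)
  case 0
  have "vec_poly h (0\<^sub>v h) = 0"
    by (simp add: vec_poly_def)
  then show ?case
    by (simp add: C_act_0)
next
  case (pCons a p)
  let ?x = "[:0, 1:] :: int poly" and ?v = "C_act h p"
  have pCons_eq: "pCons a p = [:a:] * 1 + ?x * p"
    by simp
  have "C_mat h *\<^sub>v ?v \<in> carrier_vec h"
    by (rule mult_mat_vec_carrier[OF C_mat_carrier C_act_carrier])
  then have "vec_poly h (C_act h (pCons a p)) = [:a:] * 1 + vec_poly h (C_mat h *\<^sub>v ?v)"
    unfolding pCons_eq C_act_add C_act_const_mult C_act_X_mult C_act_1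
    using vec_poly_add[of "a \<cdot>\<^sub>v ones_vec h" h "C_mat h *\<^sub>v ?v"]
    by (simp add: vec_poly_smult vec_poly_ones[OF assms])
  then have "vec_poly h (C_act h (pCons a p)) - pCons a p
      = (vec_poly h (C_mat h *\<^sub>v ?v) - ?x * vec_poly h ?v) + ?x * (vec_poly h ?v - p)"
    unfolding pCons_eq by (simp only: right_diff_distrib)
  then show ?case
    using P_poly_dvd_vec_poly_C_mat[OF assms C_act_carrier] pCons.IH
    by (simp only: dvd_add dvd_mult)
qed

section \<open>The tensor square and the specialisation Y = -X\<close>

definition tensor_poly :: "nat \<Rightarrow> int vec \<Rightarrow> int poly" where
  "tensor_poly h w = (\<Sum>t<h * h. [:w $ t:] *
     (unit_poly h (t div h) * pcompose (unit_poly h (t mod h)) (- [:0, 1:])))"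

lemma tensor_poly_0: "tensor_poly h (0\<^sub>v (h * h)) = 0"
  by (simp add: tensor_poly_def)

lemma tensor_poly_add:
  assumes "w \<in> carrier_vec (h * h)" "w' \<in> carrier_vec (h * h)"
  shows "tensor_poly h (w + w') = tensor_poly h w + tensor_poly h w'"
  unfolding tensor_poly_def sum.distrib[symmetric]
  by (rule sum.cong) (use assms in \<open>auto simp: smult_add_left\<close>)

lemma tensor_poly_kronecker_vec:
  assumes v: "v \<in> carrier_vec h" and w: "w \<in> carrier_vec h"
  shows "tensor_poly h (kronecker_vec v w) = vec_poly h v * pcompose (vec_poly h w) (- [:0, 1:])"
proof -
  let ?U = "\<lambda>j. pcompose (unit_poly h j) (- [:0, 1:])"
  have "tensor_poly h (kronecker_vec v w)
      = (\<Sum>i<h. \<Sum>j<h. [:v $ i * w $ j:] * (unit_poly h i * ?U j))"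
    unfolding tensor_poly_def sum_lessThan_mult
    by (intro sum.cong refl) (simp add: kronecker_vec_index[OF v w] del: mult_pCons_left)
  also have "\<dots> = (\<Sum>i<h. \<Sum>j<h. ([:v $ i:] * unit_poly h i) * ([:w $ j:] * ?U j))"
    by (intro sum.cong refl) (simp add: mult.commute)
  also have "\<dots> = vec_poly h v * (\<Sum>j<h. [:w $ j:] * ?U j)"
    by (simp only: vec_poly_def sum_product)
  also have "(\<Sum>j<h. [:w $ j:] * ?U j) = pcompose (vec_poly h w) (- [:0, 1:])"
    by (simp only: vec_poly_def pcompose_sum pcompose_mult pcompose_const)
  finally show ?thesis .
qed

lemma Q_mat_carrier: "Q_mat h \<in> carrier_mat (h * h) (h * h)"
  unfolding Q_mat_def by (intro add_carrier_mat kronecker_mat_carrier) simp_all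

lemma Q_mat_mult_kronecker_vec:
  assumes v: "v \<in> carrier_vec h" and w: "w \<in> carrier_vec h"
  shows "Q_mat h *\<^sub>v kronecker_vec v w =
    kronecker_vec (C_mat h *\<^sub>v v) w + kronecker_vec v (C_mat h *\<^sub>v w)"
proof -
  have "Q_mat h *\<^sub>v kronecker_vec v w = kronecker_mat (C_mat h) (1\<^sub>m h) *\<^sub>v kronecker_vec v w
      + kronecker_mat (1\<^sub>m h) (C_mat h) *\<^sub>v kronecker_vec v w"
    unfolding Q_mat_def
    by (rule add_mult_distrib_mat_vec[of _ "h * h" "h * h"])
      (intro kronecker_mat_carrier kronecker_vec_carrier v w C_mat_carrier one_carrier_mat)+
  then show ?thesis
    by (simp only: kronecker_mat_mult_vec[OF C_mat_carrier one_carrier_mat v w]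
        kronecker_mat_mult_vec[OF one_carrier_mat C_mat_carrier v w] one_mult_mat_vec[OF v]
        one_mult_mat_vec[OF w])
qed

lemma Q_image_iff: "x \<in> Q_image h \<longleftrightarrow> (\<exists>w \<in> carrier_vec (h * h). x = Q_mat h *\<^sub>v w)"
  unfolding Q_image_def power2_eq_square by auto

lemma Q_image_carrier: "x \<in> Q_image h \<Longrightarrow> x \<in> carrier_vec (h * h)"
  using Q_mat_carrier mult_mat_vec_carrier unfolding Q_image_iff by blast

lemma Q_image_0: "0\<^sub>v (h * h) \<in> Q_image h"
proof -
  have "Q_mat h *\<^sub>v 0\<^sub>v (h * h) = 0\<^sub>v (h * h)"
    using Q_mat_carrier[of h] by auto
  then show ?thesis
    unfolding Q_image_iff by (metis zero_carrier_vec)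
qed

lemma Q_image_add: "x \<in> Q_image h \<Longrightarrow> y \<in> Q_image h \<Longrightarrow> x + y \<in> Q_image h"
  unfolding Q_image_iff by (metis Q_mat_carrier add_carrier_vec mult_add_distrib_mat_vec)

lemma Q_image_diff: "x \<in> Q_image h \<Longrightarrow> y \<in> Q_image h \<Longrightarrow> x - y \<in> Q_image h"
  unfolding Q_image_iff
  by (metis Q_mat_carrier minus_carrier_vec mult_minus_distrib_mat_vec)

text \<open>
  Negation is multiplication by \<open>-1\<close>, so closure under sums and multiples suffices.
\<close>
lemma class_ring_idealI:
  fixes J :: "'a :: comm_ring_1 set"
  assumes zero: "0 \<in> J" and add: "\<And>x y. x \<in> J \<Longrightarrow> y \<in> J \<Longrightarrow> x + y \<in> J"
    and mult: "\<And>c x. x \<in> J \<Longrightarrow> c * x \<in> J"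
  shows "ideal J class_ring"
proof (rule idealI)
  show "ring (class_ring :: 'a ring)"
    by (rule class_ring.ring_axioms)
  have "inv\<^bsub>add_monoid class_ring\<^esub> x = - x" for x :: 'a
    using class_ring_simps(8) unfolding a_inv_def by metis
  moreover have "- x \<in> J" if "x \<in> J" for x
    using mult[OF that, of "-1"] by simp
  ultimately show "subgroup J (add_monoid class_ring)"
    by unfold_locales (simp_all add: zero add)
  have "x * c \<in> J" if "x \<in> J" for c x
    using mult[OF that, of c] by (simp add: mult.commute)
  then show "x \<in> J \<Longrightarrow> c \<in> carrier class_ring \<Longrightarrow> x \<otimes>\<^bsub>class_ring\<^esub> c \<in> J" for c x
    by simp
qed (simp add: mult)

lemma P_ideal_ideal: "ideal (P_ideal h) Z_poly_ring"
  unfolding P_ideal_def by (rule ring.genideal_ideal[OF class_ring.ring_axioms]) simp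

lemma P_ideal_closed:
  shows "0 \<in> P_ideal h" "p \<in> P_ideal h \<Longrightarrow> q \<in> P_ideal h \<Longrightarrow> p + q \<in> P_ideal h"
    "p \<in> P_ideal h \<Longrightarrow> c * p \<in> P_ideal h"
proof -
  interpret ideal "P_ideal h" Z_poly_ring
    by (rule P_ideal_ideal)
  show "0 \<in> P_ideal h" "p \<in> P_ideal h \<Longrightarrow> q \<in> P_ideal h \<Longrightarrow> p + q \<in> P_ideal h"
    "p \<in> P_ideal h \<Longrightarrow> c * p \<in> P_ideal h"
    using zero_closed a_closed[of p q] I_l_closed[of p c] by simp_all
qed

lemma P_ideal_iff:
  "p \<in> P_ideal h \<longleftrightarrow> (\<exists>a b. p = a * P_poly h + b * pcompose (P_poly h) (- [:0, 1:]))"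
proof
  let ?P' = "pcompose (P_poly h) (- [:0, 1:])"
  let ?J = "{p. \<exists>a b. p = a * P_poly h + b * ?P'}"
  have "ideal ?J Z_poly_ring"
  proof (rule class_ring_idealI)
    have "0 = 0 * P_poly h + 0 * ?P'"
      by simp
    then show "0 \<in> ?J"
      by blast
  next
    fix p q assume "p \<in> ?J" "q \<in> ?J"
    then obtain a b c d where "p = a * P_poly h + b * ?P'" "q = c * P_poly h + d * ?P'"
      by blast
    then have "p + q = (a + c) * P_poly h + (b + d) * ?P'"
      by (simp only: algebra_simps)
    then show "p + q \<in> ?J"
      by blast
  next
    fix c p assume "p \<in> ?J"
    then obtain a b where "p = a * P_poly h + b * ?P'"
      by blast
    then have "c * p = (c * a) * P_poly h + (c * b) * ?P'"
      by (simp only: algebra_simps)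
    then show "c * p \<in> ?J"
      by blast
  qed
  moreover have "P_poly h = 1 * P_poly h + 0 * ?P'" "?P' = 0 * P_poly h + 1 * ?P'"
    by simp_all
  then have "{P_poly h, ?P'} \<subseteq> ?J"
    by blast
  ultimately have "P_ideal h \<subseteq> ?J"
    unfolding P_ideal_def by (rule ring.genideal_minimal[OF class_ring.ring_axioms])
  then show "p \<in> P_ideal h \<Longrightarrow> \<exists>a b. p = a * P_poly h + b * ?P'"
    by blast
  have "{P_poly h, ?P'} \<subseteq> P_ideal h"
    unfolding P_ideal_def by (rule ring.genideal_self[OF class_ring.ring_axioms]) simp
  then show "\<exists>a b. p = a * P_poly h + b * ?P' \<Longrightarrow> p \<in> P_ideal h"
    by (auto intro: P_ideal_closed)
qed

text \<open>
  On a pure tensor \<open>v \<otimes> w\<close> the two summands of \<open>Q\<^sub>h\<close> contribute \<open>X\<close> and \<open>-X\<close> times the value of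
  \<open>v \<otimes> w\<close>, up to a multiple of \<open>P\<^sub>h(X)\<close> from the first factor and of \<open>P\<^sub>h(-X)\<close> from the second.
\<close>
lemma tensor_poly_Q_mat:
  assumes h: "h \<ge> 2" and w: "w \<in> carrier_vec (h * h)"
  shows "tensor_poly h (Q_mat h *\<^sub>v w) \<in> P_ideal h"
  using w
proof (induction rule: kronecker_vec_induct)
  case zero
  have "Q_mat h *\<^sub>v 0\<^sub>v (h * h) = 0\<^sub>v (h * h)"
    using Q_mat_carrier[of h] by auto
  then show ?case
    by (simp add: tensor_poly_0 P_ideal_closed)
next
  case (add u u')
  have "Q_mat h *\<^sub>v (u + u') = Q_mat h *\<^sub>v u + Q_mat h *\<^sub>v u'"
    by (rule mult_add_distrib_mat_vec[OF Q_mat_carrier add(1,2)])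
  then show ?case
    using add tensor_poly_add[OF mult_mat_vec_carrier[OF Q_mat_carrier add(1)]
        mult_mat_vec_carrier[OF Q_mat_carrier add(2)]]
    by (simp add: P_ideal_closed)
next
  case (kronecker v w)
  let ?neg = "\<lambda>p :: int poly. pcompose p (- [:0, 1:])"
  define x where "x = [:0, 1 :: int:]"
  have Cv: "C_mat h *\<^sub>v v \<in> carrier_vec h" and Cw: "C_mat h *\<^sub>v w \<in> carrier_vec h"
    using mult_mat_vec_carrier[OF C_mat_carrier] kronecker by blast+
  obtain a where a: "vec_poly h (C_mat h *\<^sub>v v) - x * vec_poly h v = P_poly h * a"
    using P_poly_dvd_vec_poly_C_mat[OF h kronecker(1)] unfolding x_def by (rule dvdE)
  obtain b where b: "vec_poly h (C_mat h *\<^sub>v w) - x * vec_poly h w = P_poly h * b"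
    using P_poly_dvd_vec_poly_C_mat[OF h kronecker(2)] unfolding x_def by (rule dvdE)
  have "?neg x = - x"
    by (simp add: x_def pcompose_pCons)
  then have b': "?neg (vec_poly h (C_mat h *\<^sub>v w)) + x * ?neg (vec_poly h w)
      = ?neg (P_poly h) * ?neg b"
    using arg_cong[OF b, of ?neg] by (simp add: pcompose_diff pcompose_mult)
  have "tensor_poly h (Q_mat h *\<^sub>v kronecker_vec v w)
      = vec_poly h (C_mat h *\<^sub>v v) * ?neg (vec_poly h w)
        + vec_poly h v * ?neg (vec_poly h (C_mat h *\<^sub>v w))"
    using kronecker Cv Cw
    by (simp add: Q_mat_mult_kronecker_vec tensor_poly_add tensor_poly_kronecker_vec)
  also have "\<dots> = (vec_poly h (C_mat h *\<^sub>v v) - x * vec_poly h v) * ?neg (vec_poly h w)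
        + vec_poly h v * (?neg (vec_poly h (C_mat h *\<^sub>v w)) + x * ?neg (vec_poly h w))"
    by (simp add: algebra_simps)
  also have "\<dots> = (a * ?neg (vec_poly h w)) * P_poly h + (vec_poly h v * ?neg b) * ?neg (P_poly h)"
    unfolding a b' by (simp only: ac_simps)
  finally show ?case
    unfolding P_ideal_iff by blast
qed

text \<open>
  Modulo the image of \<open>Q\<^sub>h = C \<otimes> 1 + 1 \<otimes> C\<close>, the matrix \<open>C\<close> acting on the second factor equals \<open>-C\<close>
  acting on the first.  Each factor \<open>X\<close> of \<open>q\<close> can thus be moved across with a change of sign.
\<close>
lemma kronecker_C_act_transfer:
  "kronecker_vec (C_act h p) (C_act h q)
     - kronecker_vec (C_act h (p * pcompose q (- [:0, 1:]))) (ones_vec h) \<in> Q_image h"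
proof (induction q arbitrary: p)
  case 0
  show ?case
    using Q_image_0[of h]
    by (simp add: C_act_0 kronecker_vec_zero_left[OF ones_vec_carrier]
        kronecker_vec_zero_right[OF C_act_carrier])
next
  case (pCons a q)
  let ?e = "ones_vec h" and ?x = "[:0, 1:] :: int poly"
  let ?v = "C_act h p" and ?w = "C_act h q" and ?q = "pcompose q (- [:0, 1:])"
  let ?K = "kronecker_vec ?v ?e" and ?L = "kronecker_vec ?v (C_mat h *\<^sub>v ?w)"
    and ?M = "kronecker_vec (C_act h (?x * p * ?q)) ?e" and ?N = "kronecker_vec (C_mat h *\<^sub>v ?v) ?w"
  have C: "C_mat h *\<^sub>v C_act h r \<in> carrier_vec h" for r
    by (rule mult_mat_vec_carrier[OF C_mat_carrier C_act_carrier])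
  have carrier: "?K \<in> carrier_vec (h * h)" "?L \<in> carrier_vec (h * h)" "?M \<in> carrier_vec (h * h)"
    "?N \<in> carrier_vec (h * h)"
    by (intro kronecker_vec_carrier C C_act_carrier ones_vec_carrier)+
  have pCons_eq: "pCons a q = [:a:] * 1 + ?x * q"
    by simp
  have left: "kronecker_vec ?v (C_act h (pCons a q)) = a \<cdot>\<^sub>v ?K + ?L"
    unfolding pCons_eq C_act_add C_act_const_mult C_act_X_mult C_act_1
    by (subst kronecker_vec_add_right[of _ h _ h])
      (simp_all add: C kronecker_vec_smult_right)
  have neg: "p * pcompose (pCons a q) (- [:0, 1:]) = [:a:] * p + [:-1:] * (?x * p * ?q)"
    by (simp add: pcompose_pCons algebra_simps)
  have right: "kronecker_vec (C_act h (p * pcompose (pCons a q) (- [:0, 1:]))) ?e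
      = a \<cdot>\<^sub>v ?K + (-1) \<cdot>\<^sub>v ?M"
    unfolding neg C_act_add C_act_const_mult
    by (subst kronecker_vec_add_left[of _ h _ _ h]) (simp_all add: kronecker_vec_smult_left)
  have "(a \<cdot>\<^sub>v k + l) - (a \<cdot>\<^sub>v k + (-1) \<cdot>\<^sub>v m) = (n + l) - (n - m)"
    if "k \<in> carrier_vec (h * h)" "l \<in> carrier_vec (h * h)" "m \<in> carrier_vec (h * h)"
      "n \<in> carrier_vec (h * h)" for k l m n
    by (rule eq_vecI) (use that in auto)
  \<comment> \<open>Passing through \<open>?N\<close>, that is \<open>C p(C) e \<otimes> q(C) e\<close>: adding \<open>?L\<close> gives a value of \<open>Q\<^sub>h\<close>,
    and the difference to \<open>?M\<close> is the induction hypothesis for \<open>X p\<close>.\<close>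
  note this[OF carrier]
  moreover have "?N + ?L \<in> Q_image h"
    unfolding Q_image_iff
    by (rule bexI[of _ "kronecker_vec ?v ?w"]) (simp_all add: Q_mat_mult_kronecker_vec)
  moreover have "?N - ?M \<in> Q_image h"
    using pCons.IH[of "?x * p"] by (simp only: C_act_X_mult)
  ultimately show ?case
    unfolding left right using Q_image_diff by metis
qed

text \<open>
  Multiples of \<open>P\<^sub>h(X)\<close> kill \<open>e\<close> in the first factor; multiples of \<open>P\<^sub>h(-X)\<close> are moved to the second
  factor, where \<open>P\<^sub>h(X)\<close> kills \<open>e\<close>.
\<close>
lemma kronecker_C_act_P_ideal:
  assumes h: "h \<ge> 2" and p: "p \<in> P_ideal h"
  shows "kronecker_vec (C_act h p) (ones_vec h) \<in> Q_image h"
proof -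
  let ?P' = "pcompose (P_poly h) (- [:0, 1:])"
  obtain a b where ab: "p = a * P_poly h + b * ?P'"
    using p unfolding P_ideal_iff by blast
  let ?K = "kronecker_vec (C_act h (b * ?P')) (ones_vec h)"
  have K: "?K \<in> carrier_vec (h * h)"
    by simp
  have "C_act h p = C_act h (b * ?P')"
    unfolding ab C_act_add C_act_mult_eq_0[OF C_act_P_poly[OF h]] by simp
  moreover have "0\<^sub>v (h * h) - ?K \<in> Q_image h"
    using kronecker_C_act_transfer[of h b "P_poly h"]
    by (simp only: C_act_P_poly[OF h] kronecker_vec_zero_right[OF C_act_carrier])
  then have "0\<^sub>v (h * h) - (0\<^sub>v (h * h) - ?K) \<in> Q_image h"
    by (rule Q_image_diff[OF Q_image_0])
  moreover have "0\<^sub>v (h * h) - (0\<^sub>v (h * h) - ?K) = ?K"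
    by (rule eq_vecI) (use K in auto)
  ultimately show ?thesis
    by simp
qed

text \<open>
  For a pure tensor \<open>v \<otimes> w\<close> with \<open>v = p(C) e\<close> and \<open>w = q(C) e\<close> the two vectors differ by moving
  \<open>q\<close> across the tensor product.
\<close>
lemma kronecker_C_act_tensor_poly:
  assumes h: "h \<ge> 2" and w: "w \<in> carrier_vec (h * h)"
  shows "w - kronecker_vec (C_act h (tensor_poly h w)) (ones_vec h) \<in> Q_image h"
  using w
proof (induction rule: kronecker_vec_induct)
  case zero
  show ?case
    using Q_image_0[of h]
    by (simp add: tensor_poly_0 C_act_0 kronecker_vec_zero_left[OF ones_vec_carrier])
next
  case (add u u')
  let ?K = "\<lambda>w. kronecker_vec (C_act h (tensor_poly h w)) (ones_vec h)"
  have "?K (u + u') = ?K u + ?K u'"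
    by (simp add: tensor_poly_add[OF add(1,2)] C_act_add kronecker_vec_add_left[of _ h _ _ h])
  moreover have "(u + u') - (k + k') = (u - k) + (u' - k')"
    if "k \<in> carrier_vec (h * h)" "k' \<in> carrier_vec (h * h)" for k k'
    using add(1,2) that by (intro eq_vecI) auto
  then have "(u + u') - (?K u + ?K u') = (u - ?K u) + (u' - ?K u')"
    by simp
  ultimately show ?case
    using Q_image_add[OF add(3,4)] by simp
next
  case (kronecker v w)
  then show ?case
    using kronecker_C_act_transfer[of h "vec_poly h v" "vec_poly h w"]
    by (simp add: tensor_poly_kronecker_vec C_act_vec_poly[OF h])
qed

lemma tensor_poly_mem_P_ideal_iff:
  assumes h: "h \<ge> 2" and w: "w \<in> carrier_vec (h * h)"
  shows "tensor_poly h w \<in> P_ideal h \<longleftrightarrow> w \<in> Q_image h"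
proof
  let ?K = "kronecker_vec (C_act h (tensor_poly h w)) (ones_vec h)"
  assume "tensor_poly h w \<in> P_ideal h"
  then have "(w - ?K) + ?K \<in> Q_image h"
    by (intro Q_image_add kronecker_C_act_tensor_poly kronecker_C_act_P_ideal h w)
  moreover have "(w - k) + k = w" if "k \<in> carrier_vec (h * h)" for k
    using w that by (intro eq_vecI) auto
  then have "(w - ?K) + ?K = w"
    by simp
  ultimately show "w \<in> Q_image h"
    by simp
next
  assume "w \<in> Q_image h"
  then show "tensor_poly h w \<in> P_ideal h"
    unfolding Q_image_iff using tensor_poly_Q_mat[OF h] by blast
qed

text \<open>
  Every residue class of polynomials is reached: \<open>p\<close> is the image of \<open>p(C) e \<otimes> e\<close> modulo \<open>P\<^sub>h\<close>.
\<close>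
lemma tensor_poly_kronecker_C_act:
  assumes h: "h \<ge> 2"
  shows "tensor_poly h (kronecker_vec (C_act h p) (ones_vec h)) - p \<in> P_ideal h"
proof -
  obtain a where "vec_poly h (C_act h p) - p = P_poly h * a"
    using P_poly_dvd_vec_poly_C_act[OF h] by (rule dvdE)
  then have "tensor_poly h (kronecker_vec (C_act h p) (ones_vec h)) - p
      = a * P_poly h + 0 * pcompose (P_poly h) (- [:0, 1:])"
    by (simp add: tensor_poly_kronecker_vec vec_poly_ones[OF h] pcompose_1 mult.commute)
  then show ?thesis
    unfolding P_ideal_iff by blast
qed

theorem proposition5:
  fixes h :: nat
  assumes "h \<ge> 2"
  shows "\<exists>\<phi> \<in> iso (monoid_vec TYPE(int) (h\<^sup>2) Mod Q_image h)
                  (add_monoid (Z_poly_ring Quot P_ideal h)).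
           \<phi> (Q_image h #>\<^bsub>monoid_vec TYPE(int) (h\<^sup>2)\<^esub> kronecker_vec (ones_vec h) (ones_vec h))
             = P_ideal h +>\<^bsub>Z_poly_ring\<^esub> 1"
proof -
  let ?R = "Z_poly_ring" and ?I = "P_ideal h"
  let ?G = "monoid_vec TYPE(int) (h\<^sup>2)" and ?H = "add_monoid (?R Quot ?I)"
  let ?e = "kronecker_vec (ones_vec h) (ones_vec h)"
  define f where "f w = ?I +>\<^bsub>?R\<^esub> tensor_poly h w" for w
  note [simp] = power2_eq_square monoid_vec_simps
  interpret I: ideal ?I ?R
    by (rule P_ideal_ideal)
  interpret quot: ring "?R Quot ?I"
    by (rule I.quotient_is_ring)
  have coset_eq: "?I +>\<^bsub>?R\<^esub> p = ?I +>\<^bsub>?R\<^esub> q \<longleftrightarrow> p - q \<in> ?I" for p q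
  proof -
    have mem: "r \<in> ?I +>\<^bsub>?R\<^esub> s \<longleftrightarrow> r - s \<in> ?I" for r s
      unfolding a_r_coset_def' by (auto intro: bexI[of _ "r - s"])
    have "r - p \<in> ?I \<longleftrightarrow> r - q \<in> ?I" if "p - q \<in> ?I" for r
      using P_ideal_closed(2)[of "r - p" h "p - q"]
        P_ideal_closed(2)[of "r - q" h "- 1 * (p - q)"] P_ideal_closed(3)[of "p - q" h "-1"] that
      by auto
    moreover have "p - p \<in> ?I"
      by (simp add: P_ideal_closed)
    ultimately show ?thesis
      unfolding set_eq_iff mem by blast
  qed
  have hom: "f \<in> hom ?G ?H"
  proof (rule homI)
    fix w assume "w \<in> carrier ?G"
    show "f w \<in> carrier ?H"
      by (auto simp: f_def FactRing_def A_RCOSETS_def')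
  next
    fix v w assume "v \<in> carrier ?G" "w \<in> carrier ?G"
    then have "tensor_poly h (v + w) = tensor_poly h v + tensor_poly h w"
      by (simp add: tensor_poly_add)
    then show "f (v \<otimes>\<^bsub>?G\<^esub> w) = f v \<otimes>\<^bsub>?H\<^esub> f w"
      using I.a_rcos_sum[of "tensor_poly h v" "tensor_poly h w"]
      by (simp add: f_def FactRing_def)
  qed
  interpret group_hom ?G ?H f
    by (intro group_hom.intro group_hom_axioms.intro hom quot.a_group
        comm_group.axioms(2) comm_group_vec)
  have "f w = \<zero>\<^bsub>?R Quot ?I\<^esub> \<longleftrightarrow> w \<in> Q_image h" if "w \<in> carrier_vec (h * h)" for w
  proof -
    have "?I +>\<^bsub>?R\<^esub> 0 = ?I"
      unfolding a_r_coset_def' by auto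
    then have "f w = \<zero>\<^bsub>?R Quot ?I\<^esub> \<longleftrightarrow> ?I +>\<^bsub>?R\<^esub> tensor_poly h w = ?I +>\<^bsub>?R\<^esub> 0"
      by (simp add: f_def FactRing_def)
    then show ?thesis
      unfolding coset_eq using tensor_poly_mem_P_ideal_iff[OF assms that] by simp
  qed
  then have kernel: "kernel ?G ?H f = Q_image h"
    using Q_image_carrier[of _ h] by (auto simp: kernel_def)
  have "f ` carrier ?G = carrier ?H"
  proof
    show "f ` carrier ?G \<subseteq> carrier ?H"
      using hom unfolding hom_def by blast
    show "carrier ?H \<subseteq> f ` carrier ?G"
    proof
      fix X assume "X \<in> carrier ?H"
      then obtain p where p: "X = ?I +>\<^bsub>?R\<^esub> p"
        by (auto simp: FactRing_def A_RCOSETS_def')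
      have "X = f (kronecker_vec (C_act h p) (ones_vec h))"
        using tensor_poly_kronecker_C_act[OF assms, of p] unfolding p f_def coset_eq[symmetric]
        by (rule sym)
      then show "X \<in> f ` carrier ?G"
        by (rule image_eqI) simp
    qed
  qed
  from FactGroup_iso_set[OF this]
  have iso: "(\<lambda>X. the_elem (f ` X)) \<in> iso (?G Mod Q_image h) ?H"
    unfolding kernel .
  have "f ` (Q_image h #>\<^bsub>?G\<^esub> ?e) = {?I +>\<^bsub>?R\<^esub> 1}"
  proof -
    have "f (x + ?e) = ?I +>\<^bsub>?R\<^esub> 1" if x: "x \<in> Q_image h" for x
    proof -
      have "tensor_poly h ?e = 1"
        by (simp add: tensor_poly_kronecker_vec vec_poly_ones[OF assms] pcompose_1)
      then have "tensor_poly h (x + ?e) - 1 = tensor_poly h x"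
        using Q_image_carrier[OF x] by (simp add: tensor_poly_add)
      then show ?thesis
        unfolding f_def coset_eq
        using tensor_poly_mem_P_ideal_iff[OF assms Q_image_carrier[OF x]] x by simp
    qed
    moreover have "Q_image h #>\<^bsub>?G\<^esub> ?e = (\<lambda>x. x + ?e) ` Q_image h"
      by (auto simp: r_coset_def)
    ultimately show ?thesis
      using Q_image_0[of h] by (auto simp: image_image)
  qed
  then show ?thesis
    by (intro bexI[OF _ iso]) simp
qed

end
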